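(* Let $T_1,\dots,T_5\in\mathcal{B}_A(\mathcal{H})$ and let $\mathrm{i}$ denote the imaginary unit. Then $$w_{\mathbb{A}}\left(\begin{bmatrix}T_1&T_2&T_3&T_4&T_5\\ T_2&T_3&T_4&T_5&\mathrm{i}T_1\\ T_3&T_4&T_5&\mathrm{i}T_1&\mathrm{i}T_2\\ T_4&T_5&\mathrm{i}T_1&\mathrm{i}T_2&\mathrm{i}T_3\\ T_5&\mathrm{i}T_1&\mathrm{i}T_2&\mathrm{i}T_3&\mathrm{i}T_4\end{bmatrix}\right)\le w_A(T_5)+\max\{w_A(T_2),w_A(T_3)\}+\max\{w_A(T_1),w_A(T_4)\}+\frac1{\sqrt2}\sum_{k=1}^3\left(\|T_{k+1}-T_k\|_A+\|T_{k+1}+T_k\|_A\right)+\sqrt{w_A^2(T_4)+w_A^2(T_2)}.$$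
   Context: $\mathcal{H}$ is a complex Hilbert space with inner product $\langle\cdot,\cdot\rangle$, $\mathcal{B}(\mathcal{H})$ is the algebra of bounded linear operators on $\mathcal{H}$, and $A\in\mathcal{B}(\mathcal{H})$ is a fixed positive operator ($\langle Ax,x\rangle\ge 0$ for all $x$). Put $\langle x,y\rangle_A=\langle Ax,y\rangle$ and $\|x\|_A=\sqrt{\langle x,x\rangle_A}$. $\mathcal{B}_A(\mathcal{H})$ is the set of $T\in\mathcal{B}(\mathcal{H})$ admitting an $A$-adjoint, i.e. for which there is $X\in\mathcal{B}(\mathcal{H})$ with $AX=T^*A$ (equivalently $\mathcal{R}(T^*A)\subseteq\mathcal{R}(A)$). The $A$-operator seminorm is $\|T\|_A=\sup_{x\in\overline{\mathcal{R}(A)},\,x\ne0}\|Tx\|_A/\|x\|_A$ and the $A$-numerical radius is $w_A(T)=\sup\{|\langle Tx,x\rangle_A|: x\in\mathcal{H},\ \|x\|_A=1\}$; $w_A^2(\cdot)$ means $(w_A(\cdot))^2$. $\mathbb{A}$ denotes the $5\times5$ block diagonal operator matrix on $\bigoplus_{i=1}^5\mathcal{H}$ with all diagonal entries $A$, and $w_{\mathbb{A}}$ is the numerical radius defined in the same way with $\mathcal{H},A$ replaced by $\bigoplus_{i=1}^5\mathcal{H},\mathbb{A}$. *)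

theory Defs
  imports "HOL-Analysis.Analysis" "HOL-Library.Function_Algebras"
begin

section \<open>Complex Hilbert spaces\<close>

text \<open>The inner product is linear in its first argument. Positivity and definiteness are contained
  in the last axiom, which says that the norm is the one induced by the inner product.\<close>

class complex_inner = real_normed_vector +
  fixes scaleC :: "complex \<Rightarrow> 'a \<Rightarrow> 'a" (infixr "*\<^sub>C" 75)
    and cinner :: "'a \<Rightarrow> 'a \<Rightarrow> complex"
  assumes scaleC_add_right: "c *\<^sub>C (x + y) = c *\<^sub>C x + c *\<^sub>C y"
    and scaleC_add_left: "(c + d) *\<^sub>C x = c *\<^sub>C x + d *\<^sub>C x"
    and scaleC_scaleC: "c *\<^sub>C d *\<^sub>C x = (c * d) *\<^sub>C x"
    and scaleC_of_real: "complex_of_real r *\<^sub>C x = r *\<^sub>R x"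
    and cinner_commute: "cinner x y = cnj (cinner y x)"
    and cinner_add_left: "cinner (x + y) z = cinner x z + cinner y z"
    and cinner_scaleC_left: "cinner (c *\<^sub>C x) y = c * cinner x y"
    and cinner_self: "cinner x x = complex_of_real ((norm x)\<^sup>2)"

class chilbert_space = complex_inner + complete_space
begin
subclass banach ..
end

instantiation vec :: (complex_inner, finite) complex_inner
begin
definition scaleC_vec :: "complex \<Rightarrow> 'a ^ 'b \<Rightarrow> 'a ^ 'b"
  where "c *\<^sub>C x = (\<chi> i. c *\<^sub>C (x $ i))"
definition cinner_vec :: "'a ^ 'b \<Rightarrow> 'a ^ 'b \<Rightarrow> complex"
  where "cinner x y = (\<Sum>i\<in>UNIV. cinner (x $ i) (y $ i))"
instance
proof
  fix c d :: complex and r :: real and x y z :: "'a ^ 'b"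
  show "c *\<^sub>C (x + y) = c *\<^sub>C x + c *\<^sub>C y"
    by (simp add: vec_eq_iff scaleC_vec_def scaleC_add_right)
  show "(c + d) *\<^sub>C x = c *\<^sub>C x + d *\<^sub>C x"
    by (simp add: vec_eq_iff scaleC_vec_def scaleC_add_left)
  show "c *\<^sub>C d *\<^sub>C x = (c * d) *\<^sub>C x"
    by (simp add: vec_eq_iff scaleC_vec_def scaleC_scaleC)
  show "complex_of_real r *\<^sub>C x = r *\<^sub>R x"
    by (simp add: vec_eq_iff scaleC_vec_def scaleC_of_real)
  show "cinner x y = cnj (cinner y x)"
    unfolding cinner_vec_def cnj_sum by (rule sum.cong) (auto intro: cinner_commute)
  show "cinner (x + y) z = cinner x z + cinner y z"
    by (simp add: cinner_vec_def cinner_add_left sum.distrib)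
  show "cinner (c *\<^sub>C x) y = c * cinner x y"
    by (simp add: cinner_vec_def scaleC_vec_def cinner_scaleC_left sum_distrib_left)
  show "cinner x x = complex_of_real ((norm x)\<^sup>2)"
    by (simp add: cinner_vec_def norm_vec_def L2_set_def cinner_self sum_nonneg)
qed
end

instance vec :: (chilbert_space, finite) chilbert_space ..

lemma norm_sq_cinner: "(norm x)\<^sup>2 = Re (cinner x x)"
  by (simp add: cinner_self)

lemma cinner_add_right: "cinner x (y + z) = cinner x y + cinner x z"
  by (metis cinner_add_left cinner_commute complex_cnj_add)

lemma cinner_scaleC_right: "cinner x (c *\<^sub>C y) = cnj c * cinner x y"
  by (metis cinner_commute cinner_scaleC_left complex_cnj_mult)

lemma cinner_diff_left: "cinner (x - y) z = cinner x z - cinner y z"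
  by (metis add_diff_cancel_right' cinner_add_left diff_add_cancel)

lemma cinner_diff_right: "cinner x (y - z) = cinner x y - cinner x z"
  by (metis add_diff_cancel_right' cinner_add_right diff_add_cancel)

lemma cinner_zero_left [simp]: "cinner 0 x = 0"
  using cinner_diff_left[of x x x] by simp

lemma cinner_zero_right [simp]: "cinner x 0 = 0"
  using cinner_diff_right[of x x x] by simp


section \<open>Bounded operators and the Hilbert space adjoint\<close>

definition bounded_clinear :: "('a::complex_inner \<Rightarrow> 'b::complex_inner) \<Rightarrow> bool"
  where "bounded_clinear T \<longleftrightarrow> bounded_linear T \<and> (\<forall>c x. T (c *\<^sub>C x) = c *\<^sub>C T x)"

definition cadjoint :: "('a::chilbert_space \<Rightarrow> 'a) \<Rightarrow> 'a \<Rightarrow> 'a"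
  where "cadjoint T = (THE S. \<forall>x y. cinner (T x) y = cinner x (S y))"

definition positive_op :: "('a::complex_inner \<Rightarrow> 'a) \<Rightarrow> bool"
  where "positive_op A \<longleftrightarrow> bounded_clinear A \<and> (\<forall>x. cinner (A x) x \<in> \<real>\<^sub>\<ge>\<^sub>0)"

text \<open>The Riesz representation theorem, from which \<^const>\<open>cadjoint\<close> is well defined.\<close>

lemma parallelogram:
  fixes x y :: "'a::complex_inner"
  shows "(norm (x + y))\<^sup>2 + (norm (x - y))\<^sup>2 = 2 * (norm x)\<^sup>2 + 2 * (norm y)\<^sup>2"
  by (simp add: norm_sq_cinner cinner_add_left cinner_add_right cinner_diff_left cinner_diff_right)

lemma norm_sq_minus_projection:
  fixes x y :: "'a::complex_inner"
  assumes "y \<noteq> 0"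
  shows "(norm (x - (cinner x y / complex_of_real ((norm y)\<^sup>2)) *\<^sub>C y))\<^sup>2
    = (norm x)\<^sup>2 - (cmod (cinner x y))\<^sup>2 / (norm y)\<^sup>2"
proof -
  define n where "n = (norm y)\<^sup>2"
  have n: "n > 0" using assms by (simp add: n_def)
  define a where "a = cinner x y"
  define c where "c = a / complex_of_real n"
  have yx: "cinner y x = cnj a" by (simp add: a_def cinner_commute[of y x])
  have "cinner (x - c *\<^sub>C y) (x - c *\<^sub>C y)
      = cinner x x - cnj c * a - c * cnj a + c * cnj c * complex_of_real n"
    by (simp add: cinner_diff_left cinner_diff_right cinner_scaleC_left cinner_scaleC_right
        yx a_def[symmetric] cinner_self[of y] n_def[symmetric] algebra_simps)
  also have "\<dots> = cinner x x - a * cnj a / complex_of_real n"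
    using n by (simp add: c_def field_simps)
  also have "\<dots> = cinner x x - complex_of_real ((cmod a)\<^sup>2 / n)"
    by (metis complex_norm_square of_real_divide)
  finally have "(norm (x - c *\<^sub>C y))\<^sup>2 = (norm x)\<^sup>2 - (cmod a)\<^sup>2 / n"
    by (simp add: norm_sq_cinner)
  then show ?thesis by (simp add: c_def a_def n_def)
qed

lemma minimal_norm_orthogonal:
  fixes u v :: "'a::complex_inner"
  assumes "\<And>c. norm u \<le> norm (u - c *\<^sub>C v)"
  shows "cinner v u = 0"
proof (cases "v = 0")
  case False
  have "(norm u)\<^sup>2 \<le> (norm u)\<^sup>2 - (cmod (cinner u v))\<^sup>2 / (norm v)\<^sup>2"
    unfolding norm_sq_minus_projection[OF False, symmetric] using assms by (simp add: power_mono)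
  then have "cinner u v = 0" using False by (simp add: divide_le_0_iff)
  then show ?thesis by (simp add: cinner_commute[of v u])
qed simp

lemma cinner_cauchy_schwarz: "cmod (cinner x y) \<le> norm x * norm y"
proof (cases "y = 0")
  case False
  have "0 \<le> (norm x)\<^sup>2 - (cmod (cinner x y))\<^sup>2 / (norm y)\<^sup>2"
    unfolding norm_sq_minus_projection[OF False, symmetric] by simp
  then have "(cmod (cinner x y))\<^sup>2 \<le> (norm x * norm y)\<^sup>2"
    using False by (simp add: field_simps)
  then show ?thesis by (rule power2_le_imp_le) simp
qed simp

lemma riesz_representation:
  fixes f :: "'a::chilbert_space \<Rightarrow> complex"
  assumes lin: "bounded_linear f" and sc: "\<And>c x. f (c *\<^sub>C x) = c * f x"
  shows "\<exists>z. \<forall>x. f x = cinner x z"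
proof (cases "\<exists>w. f w \<noteq> 0")
  case False
  then show ?thesis by (intro exI[of _ 0]) auto
next
  case True
  interpret bounded_linear f by (rule lin)
  from True obtain w where w: "f w \<noteq> 0" by blast
  define M where "M = {x. f x = 1}"
  have "f ((1 / f w) *\<^sub>C w) = 1" using w by (simp add: sc)
  then have Mne: "M \<noteq> {}" by (auto simp: M_def)
  define D where "D = (\<lambda>x. (norm x)\<^sup>2) ` M"
  define d where "d = Inf D"
  have Dne: "D \<noteq> {}" using Mne by (simp add: D_def)
  have Dbdd: "bdd_below D" by (auto simp: D_def intro!: bdd_belowI[of _ 0])
  have d_le: "d \<le> (norm x)\<^sup>2" if "x \<in> M" for x
    unfolding d_def using that Dbdd by (intro cInf_lower) (auto simp: D_def)
  have "\<exists>x\<in>M. (norm x)\<^sup>2 < d + 1 / real (Suc n)" for n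
  proof -
    have "Inf D < d + 1 / real (Suc n)" by (simp add: d_def)
    then obtain t where "t \<in> D" "t < d + 1 / real (Suc n)"
      using cInf_less_iff[OF Dne Dbdd] by blast
    then show ?thesis by (auto simp: D_def)
  qed
  then obtain X where XM: "\<And>n. X n \<in> M" and X: "\<And>n. (norm (X n))\<^sup>2 < d + 1 / real (Suc n)"
    by metis
  have dist_X: "(norm (X m - X n))\<^sup>2 \<le> 2 / real (Suc m) + 2 / real (Suc n)" for m n
  proof -
    have "f ((1/2::real) *\<^sub>R (X m + X n)) = 1"
      using XM[of m] XM[of n] by (simp add: M_def scaleR add scaleR_conv_of_real)
    then have "d \<le> (norm ((1/2::real) *\<^sub>R (X m + X n)))\<^sup>2"
      by (intro d_le) (simp add: M_def)
    also have "\<dots> = (norm (X m + X n))\<^sup>2 / 4" by (simp add: power_divide)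
    finally have "4 * d \<le> (norm (X m + X n))\<^sup>2" by simp
    then show ?thesis using parallelogram[of "X m" "X n"] X[of m] X[of n]
      by (simp add: divide_inverse)
  qed
  have "Cauchy X"
  proof (rule CauchyI)
    fix e :: real assume e: "e > 0"
    obtain N where N: "4 / e\<^sup>2 < real N" using reals_Archimedean2 by blast
    have "norm (X m - X n) < e" if "m \<ge> N" "n \<ge> N" for m n
    proof -
      have N0: "real N > 0" using N e less_trans[of 0 "4 / e\<^sup>2" "real N"] by simp
      have less: "2 / real (Suc k) < 2 / real N" if "k \<ge> N" for k
        using that N0 by (intro divide_strict_left_mono) auto
      then have "(norm (X m - X n))\<^sup>2 < 4 / real N"
        using dist_X[of m n] less[OF that(1)] less[OF that(2)] by simp
      also have "\<dots> \<le> e\<^sup>2"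
        using N N0 e less_imp_le[OF N] by (simp add: pos_divide_le_eq mult.commute)
      finally show ?thesis by (rule power2_less_imp_less) (use e in simp)
    qed
    then show "\<exists>N. \<forall>m\<ge>N. \<forall>n\<ge>N. norm (X m - X n) < e" by blast
  qed
  then obtain u where u: "X \<longlonglongrightarrow> u"
    using Cauchy_convergent convergent_def by blast
  have "(\<lambda>n. f (X n)) \<longlonglongrightarrow> f u" using u by (rule tendsto)
  moreover have "(\<lambda>n. f (X n)) = (\<lambda>n. 1)" using XM by (auto simp: M_def)
  ultimately have fu: "f u = 1" by (simp add: LIMSEQ_const_iff)
  have "(\<lambda>n. (norm (X n))\<^sup>2) \<longlonglongrightarrow> (norm u)\<^sup>2" using u by (intro tendsto_intros)
  moreover have "(\<lambda>n. d + 1 / real (Suc n)) \<longlonglongrightarrow> d + 0"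
    by (intro tendsto_intros LIMSEQ_Suc[OF lim_1_over_n])
  ultimately have ud: "(norm u)\<^sup>2 \<le> d"
    using LIMSEQ_le[of "\<lambda>n. (norm (X n))\<^sup>2" "(norm u)\<^sup>2" "\<lambda>n. d + 1 / real (Suc n)" "d + 0"]
      less_imp_le[OF X] by simp
  have orth: "cinner v u = 0" if v: "f v = 0" for v
  proof (rule minimal_norm_orthogonal)
    fix c
    have "f (u - c *\<^sub>C v) = 1" by (simp add: diff sc v fu)
    then have "d \<le> (norm (u - c *\<^sub>C v))\<^sup>2" by (intro d_le) (simp add: M_def)
    then have "(norm u)\<^sup>2 \<le> (norm (u - c *\<^sub>C v))\<^sup>2" using ud by linarith
    then show "norm u \<le> norm (u - c *\<^sub>C v)" by (rule power2_le_imp_le) simp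
  qed
  have u0: "u \<noteq> 0" using fu zero by auto
  define z where "z = complex_of_real (1 / (norm u)\<^sup>2) *\<^sub>C u"
  have "f x = cinner x z" for x
  proof -
    have "f (x - f x *\<^sub>C u) = 0" by (simp add: diff sc fu)
    then have "cinner (x - f x *\<^sub>C u) u = 0" by (rule orth)
    then have "cinner x u = f x * complex_of_real ((norm u)\<^sup>2)"
      by (simp add: cinner_diff_left cinner_scaleC_left cinner_self)
    then show ?thesis using u0 by (simp add: z_def cinner_scaleC_right)
  qed
  then show ?thesis by blast
qed

lemma cinner_ext_right:
  assumes "\<And>x. cinner x y = cinner x z"
  shows "y = z"
proof -
  have "cinner (y - z) (y - z) = 0" using assms by (simp add: cinner_diff_right)
  then show ?thesis by (simp add: cinner_self)
qed

lemma cadjoint_works: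
  fixes T :: "'a::chilbert_space \<Rightarrow> 'a"
  assumes T: "bounded_clinear T"
  shows "cinner (T x) y = cinner x (cadjoint T y)"
proof -
  interpret bounded_linear T using T by (simp add: bounded_clinear_def)
  obtain K where K: "\<And>x. norm (T x) \<le> norm x * K" using bounded by blast
  have "\<exists>z. \<forall>x. cinner (T x) y = cinner x z" for y
  proof (rule riesz_representation)
    show "bounded_linear (\<lambda>x. cinner (T x) y)"
    proof (rule bounded_linear_intro)
      show "cinner (T (x + x')) y = cinner (T x) y + cinner (T x') y" for x x'
        by (simp add: add cinner_add_left)
      show "cinner (T (r *\<^sub>R x)) y = r *\<^sub>R cinner (T x) y" for r x
        unfolding scaleR by (simp only: scaleC_of_real[symmetric] cinner_scaleC_left scaleR_conv_of_real)
      show "cmod (cinner (T x) y) \<le> norm x * (K * norm y)" for x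
        using cinner_cauchy_schwarz[of "T x" y] mult_right_mono[OF K[of x], of "norm y"]
        by (simp add: mult.assoc)
    qed
    show "cinner (T (c *\<^sub>C x)) y = c * cinner (T x) y" for c x
      using T by (simp add: bounded_clinear_def cinner_scaleC_left)
  qed
  then obtain S where S: "\<forall>x y. cinner (T x) y = cinner x (S y)" by metis
  have "\<forall>x y. cinner (T x) y = cinner x (cadjoint T y)"
    unfolding cadjoint_def
  proof (rule theI[of "\<lambda>S. \<forall>x y. cinner (T x) y = cinner x (S y)", OF S])
    fix S' assume "\<forall>x y. cinner (T x) y = cinner x (S' y)"
    with S have "cinner x (S' y) = cinner x (S y)" for x y by metis
    then show "S' = S" by (intro ext cinner_ext_right)
  qed
  then show ?thesis by blast
qed


section \<open>The semi-inner product induced by a positive operator\<close>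

definition innerA :: "('a::complex_inner \<Rightarrow> 'a) \<Rightarrow> 'a \<Rightarrow> 'a \<Rightarrow> complex"
  where "innerA A x y = cinner (A x) y"

definition normA :: "('a::complex_inner \<Rightarrow> 'a) \<Rightarrow> 'a \<Rightarrow> real"
  where "normA A x = sqrt (Re (innerA A x x))"

definition BA :: "('a::chilbert_space \<Rightarrow> 'a) \<Rightarrow> ('a \<Rightarrow> 'a) set"
  where "BA A = {T. bounded_clinear T \<and> (\<exists>X. bounded_clinear X \<and> A \<circ> X = cadjoint T \<circ> A)}"

text \<open>Both suprema are taken in the interval from 0 to infinity. Inserting 0 only matters for
  \<open>A = 0\<close>, where the sets are empty: it makes the supremum 0, whereas the supremum of the
  empty set of reals is unspecified in HOL. For \<open>T \<in> BA A\<close> with \<open>A\<close> positive both sets are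
  bounded; for other operators they need not be, and then the values carry no meaning.\<close>

definition opnormA :: "('a::complex_inner \<Rightarrow> 'a) \<Rightarrow> ('a \<Rightarrow> 'a) \<Rightarrow> real"
  where "opnormA A T =
    Sup (insert 0 {normA A (T x) / normA A x | x. x \<in> closure (range A) \<and> x \<noteq> 0})"

definition wA :: "('a::complex_inner \<Rightarrow> 'a) \<Rightarrow> ('a \<Rightarrow> 'a) \<Rightarrow> real"
  where "wA A T = Sup (insert 0 {cmod (innerA A (T x) x) | x. normA A x = 1})"


section \<open>Operator matrices\<close>

definition op_scale :: "complex \<Rightarrow> ('a::complex_inner \<Rightarrow> 'a) \<Rightarrow> 'a \<Rightarrow> 'a" (infixr "*\<^sub>O" 75)
  where "c *\<^sub>O T = (\<lambda>x. c *\<^sub>C T x)"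

definition op_matrix :: "('a::complex_inner \<Rightarrow> 'a) ^ 'n ^ 'n \<Rightarrow> 'a ^ 'n \<Rightarrow> 'a ^ 'n"
  where "op_matrix M x = (\<chi> i. \<Sum>j\<in>UNIV. (M $ i $ j) (x $ j))"

text \<open>Sums, differences and the zero of operators are the pointwise ones of
  \<^theory>\<open>HOL-Library.Function_Algebras\<close>, so \<^const>\<open>mat\<close> is usable for block diagonals. In the
  five-element index type the numeral 5 denotes 0; the indices \<open>1, \<dots>, 5\<close> are nevertheless
  distinct and \<^const>\<open>vector\<close> lists the entries in this order.\<close>

lemma vector_5 [simp]:
  "(vector [a, b, c, d, e] :: 'a::zero ^ 5) $ 1 = a"
  "(vector [a, b, c, d, e] :: 'a::zero ^ 5) $ 2 = b"
  "(vector [a, b, c, d, e] :: 'a::zero ^ 5) $ 3 = c"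
  "(vector [a, b, c, d, e] :: 'a::zero ^ 5) $ 4 = d"
  "(vector [a, b, c, d, e] :: 'a::zero ^ 5) $ 5 = e"
  unfolding vector_def by simp_all

lemma op_matrix_mat: "op_matrix (mat A) x = (\<chi> i. A (x $ i))"
  by (simp add: op_matrix_def mat_def vec_eq_iff if_distrib[of "\<lambda>f. f _"] if_distribR sum.delta
      cong: if_cong)

end

theory Submission
  imports Defs
begin

text \<open>
  The operator matrix is \<open>\<Sum>k. T k \<otimes> U k\<close>, where \<open>U k\<close> is a generalized permutation matrix with
  entries \<open>1\<close> and \<open>\<i>\<close>: up to the factors \<open>\<i>\<close>, it is the permutation matrix of an involution of the five
  indices, and each factor is constant on the orbits of that involution. Hence the quadratic form
  of \<open>T k \<otimes> U k\<close> is a sum over orbits of unimodular multiples of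
  \<open>\<langle>T x\<^sub>i, x\<^sub>i\<rangle>\<^sub>A\<close> or \<open>\<langle>T x\<^sub>i, x\<^sub>j\<rangle>\<^sub>A + \<langle>T x\<^sub>j, x\<^sub>i\<rangle>\<^sub>A\<close>, and polarization together with the parallelogram law bounds
  each of the latter by \<open>w\<^sub>A(T) (\<parallel>x\<^sub>i\<parallel>\<^sub>A\<^sup>2 + \<parallel>x\<^sub>j\<parallel>\<^sub>A\<^sup>2)\<close> (\<open>cmod_symmetric_pair_le_wA\<close>). So the
  numerical radius of the matrix is at most \<open>w\<^sub>A(T\<^sub>1) + \<dots> + w\<^sub>A(T\<^sub>5)\<close>.

  This sum is at most the stated bound. From \<open>2 T = (S + T) - (S - T)\<close>, the corresponding
  identity for \<open>S\<close>, and \<open>w\<^sub>A \<le> \<parallel>\<cdot>\<parallel>\<^sub>A\<close> one gets that \<open>\<parallel>S - T\<parallel>\<^sub>A + \<parallel>S + T\<parallel>\<^sub>A\<close> is at least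
  \<open>2 w\<^sub>A(S)\<close> and at least \<open>2 w\<^sub>A(T)\<close>. Since \<open>1 / \<surd>2 \<ge> 1 / 2\<close>, the sum over \<open>k = 1, 2, 3\<close> dominates
  \<open>w\<^sub>A(T\<^sub>1) + w\<^sub>A(T\<^sub>2) + w\<^sub>A(T\<^sub>4)\<close>; the first maximum dominates \<open>w\<^sub>A(T\<^sub>3)\<close>.

  Two analytic facts make the seminorms behave. Operators with an A-adjoint are bounded with
  respect to \<open>\<parallel>\<cdot>\<parallel>\<^sub>A\<close> (\<open>BA_imp_A_bounded\<close>), so that the suprema are finite. The range of \<open>A\<close> is dense
  for \<open>\<parallel>\<cdot>\<parallel>\<^sub>A\<close> (\<open>range_dense\<close>), so that \<open>\<parallel>T\<parallel>\<^sub>A\<close>, a supremum over the closure of the range, controls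
  \<open>T\<close> on the whole space (\<open>normA_le_opnormA\<close>).
\<close>

section \<open>The semi-inner product of a positive operator\<close>

locale positive_operator =
  fixes A :: "'a::complex_inner \<Rightarrow> 'a"
  assumes positive: "positive_op A"
begin

lemma bounded_linear_A: "bounded_linear A"
  using positive by (simp add: positive_op_def bounded_clinear_def)

lemma A_scaleC: "A (c *\<^sub>C x) = c *\<^sub>C A x"
  using positive by (simp add: positive_op_def bounded_clinear_def)

lemmas A_simps = linear_simps[OF bounded_linear_A] A_scaleC

lemma innerA_add_left: "innerA A (x + y) z = innerA A x z + innerA A y z"
  by (simp add: innerA_def A_simps cinner_add_left)

lemma innerA_add_right: "innerA A x (y + z) = innerA A x y + innerA A x z"
  by (simp add: innerA_def cinner_add_right)

lemma innerA_diff_left: "innerA A (x - y) z = innerA A x z - innerA A y z"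
  by (simp add: innerA_def A_simps cinner_diff_left)

lemma innerA_diff_right: "innerA A x (y - z) = innerA A x y - innerA A x z"
  by (simp add: innerA_def cinner_diff_right)

lemma innerA_scaleC_left: "innerA A (c *\<^sub>C x) y = c * innerA A x y"
  by (simp add: innerA_def A_simps cinner_scaleC_left)

lemma innerA_scaleC_right: "innerA A x (c *\<^sub>C y) = cnj c * innerA A x y"
  by (simp add: innerA_def cinner_scaleC_right)

lemmas innerA_simps = innerA_add_left innerA_add_right innerA_diff_left innerA_diff_right
  innerA_scaleC_left innerA_scaleC_right

lemma innerA_self_nonneg: "innerA A x x \<in> \<real>\<^sub>\<ge>\<^sub>0"
  using positive by (simp add: positive_op_def innerA_def)

lemma innerA_self: "innerA A x x = complex_of_real ((normA A x)\<^sup>2)"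
  using innerA_self_nonneg[of x]
  by (auto simp: normA_def nonneg_Reals_def complex_eq_iff)

lemma normA_nonneg [simp]: "normA A x \<ge> 0"
  using innerA_self_nonneg[of x] by (auto simp: normA_def nonneg_Reals_def)

lemma normA_sq: "(normA A x)\<^sup>2 = Re (innerA A x x)"
  by (simp add: innerA_self)

text \<open>Over the complex numbers, a form that is real on the diagonal is Hermitian: polarize with
  \<open>x + y\<close> and \<open>x + \<i> y\<close>.\<close>

lemma innerA_commute: "innerA A x y = cnj (innerA A y x)"
proof -
  have real: "Im (innerA A z z) = 0" for z
    by (simp add: innerA_self)
  have "Im (innerA A x y) + Im (innerA A y x) = 0"
    using real[of "x + y"] real[of x] real[of y] by (simp add: innerA_simps)
  moreover have "Re (innerA A x y) = Re (innerA A y x)"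
    using real[of "x + \<i> *\<^sub>C y"] real[of x] real[of y] by (simp add: innerA_simps)
  ultimately show ?thesis
    by (simp add: complex_eq_iff)
qed

lemma self_adjoint: "cinner (A x) y = cinner x (A y)"
  using innerA_commute[of x y] cinner_commute[of x "A y"] by (simp add: innerA_def)

text \<open>Since \<open>normA A\<close> may vanish on nonzero vectors, the coefficient of the projection of \<open>x\<close> onto
  \<open>y\<close> may have denominator 0. The square of the seminorm of \<open>x - t s y\<close>, with
  \<open>s = \<langle>x, y\<rangle>\<^sub>A\<close>, is nonnegative for all real \<open>t\<close>; a suitable \<open>t\<close> gives the inequality in the regular case and \<open>s = 0\<close> in the degenerate one.\<close>

lemma innerA_cauchy_schwarz: "cmod (innerA A x y) \<le> normA A x * normA A y"
proof -
  define s where "s = innerA A x y"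
  have yx: "innerA A y x = cnj s"
    unfolding s_def by (rule innerA_commute)
  have expand: "0 \<le> (normA A x)\<^sup>2 - 2 * t * (cmod s)\<^sup>2 + t\<^sup>2 * (cmod s)\<^sup>2 * (normA A y)\<^sup>2"
    for t :: real
  proof -
    define c where "c = complex_of_real t * s"
    have "innerA A (x - c *\<^sub>C y) (x - c *\<^sub>C y)
        = innerA A x x - cnj c * s - c * cnj s + c * cnj c * innerA A y y"
      by (simp add: innerA_simps yx s_def[symmetric] algebra_simps)
    also have "\<dots> = complex_of_real ((normA A x)\<^sup>2) - 2 * complex_of_real t * (s * cnj s)
        + (complex_of_real t)\<^sup>2 * (s * cnj s) * complex_of_real ((normA A y)\<^sup>2)"
      by (simp add: c_def innerA_self algebra_simps power2_eq_square)
    also have "s * cnj s = complex_of_real ((cmod s)\<^sup>2)"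
      by (simp only: complex_norm_square)
    finally have "(normA A (x - c *\<^sub>C y))\<^sup>2
        = (normA A x)\<^sup>2 - 2 * t * (cmod s)\<^sup>2 + t\<^sup>2 * (cmod s)\<^sup>2 * (normA A y)\<^sup>2"
      unfolding normA_sq by (simp flip: of_real_power)
    then show ?thesis
      by (metis zero_le_power2)
  qed
  have "(cmod s)\<^sup>2 \<le> (normA A x * normA A y)\<^sup>2"
  proof (cases "normA A y = 0")
    case True
    have "s = 0"
    proof (rule ccontr)
      assume "s \<noteq> 0"
      \<comment> \<open>The quadratic polynomial in \<open>t\<close> has become affine with negative slope; at this \<open>t\<close> its
        value is \<open>-1\<close>.\<close>
      then have "2 * (((normA A x)\<^sup>2 + 1) / (2 * (cmod s)\<^sup>2)) * (cmod s)\<^sup>2 = (normA A x)\<^sup>2 + 1"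
        by simp
      then show False
        using expand[of "((normA A x)\<^sup>2 + 1) / (2 * (cmod s)\<^sup>2)"] True by simp
    qed
    then show ?thesis by simp
  next
    case False
    then have "0 < (normA A y)\<^sup>2"
      by simp
    then show ?thesis
      using expand[of "1 / (normA A y)\<^sup>2"] False
      by (simp add: field_simps power2_eq_square zero_le_divide_iff)
  qed
  then show ?thesis
    unfolding s_def by (rule power2_le_imp_le) simp
qed

lemma normA_scaleC: "normA A (c *\<^sub>C x) = cmod c * normA A x"
proof -
  have "innerA A (c *\<^sub>C x) (c *\<^sub>C x) = (c * cnj c) * innerA A x x"
    by (simp add: innerA_simps)
  also have "\<dots> = complex_of_real ((cmod c * normA A x)\<^sup>2)"
    by (simp add: innerA_self power_mult_distrib flip: complex_norm_square)
  finally have "(normA A (c *\<^sub>C x))\<^sup>2 = (cmod c * normA A x)\<^sup>2"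
    unfolding normA_sq by simp
  then show ?thesis
    by (simp add: power2_eq_iff_nonneg)
qed

lemma normA_add_sq: "(normA A (x + y))\<^sup>2 = (normA A x)\<^sup>2 + 2 * Re (innerA A x y) + (normA A y)\<^sup>2"
  unfolding normA_sq using innerA_commute[of y x] by (simp add: innerA_simps)

lemma normA_diff_sq: "(normA A (x - y))\<^sup>2 = (normA A x)\<^sup>2 - 2 * Re (innerA A x y) + (normA A y)\<^sup>2"
  unfolding normA_sq using innerA_commute[of y x] by (simp add: innerA_simps)

lemma normA_triangle: "normA A (x + y) \<le> normA A x + normA A y"
proof (rule power2_le_imp_le)
  have "Re (innerA A x y) \<le> normA A x * normA A y"
    using complex_Re_le_cmod innerA_cauchy_schwarz order_trans by blast
  then show "(normA A (x + y))\<^sup>2 \<le> (normA A x + normA A y)\<^sup>2"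
    by (simp add: normA_add_sq power2_sum)
qed simp

lemma normA_minus: "normA A (- x) = normA A x"
  by (simp add: normA_def innerA_def A_simps cinner_diff_left[of 0, simplified]
      cinner_diff_right[of _ 0, simplified])

lemma normA_triangle_diff: "normA A (x - y) \<le> normA A x + normA A y"
  using normA_triangle[of x "- y"] by (simp add: normA_minus)

lemma normA_le_norm: "\<exists>K>0. \<forall>x. normA A x \<le> K * norm x"
proof -
  obtain K where K: "K > 0" "\<And>x. norm (A x) \<le> norm x * K"
    using bounded_linear.pos_bounded[OF bounded_linear_A] by blast
  have "normA A x \<le> sqrt K * norm x" for x
  proof -
    have "Re (innerA A x x) \<le> norm (A x) * norm x"
      unfolding innerA_def using complex_Re_le_cmod cinner_cauchy_schwarz order_trans by blast
    also have "\<dots> \<le> K * (norm x)\<^sup>2"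
      using mult_right_mono[OF K(2)[of x], of "norm x"]
      by (simp add: power2_eq_square algebra_simps)
    finally show ?thesis
      unfolding normA_def using K(1)
      by (metis norm_ge_zero real_sqrt_le_mono real_sqrt_mult real_sqrt_abs abs_norm_cancel)
  qed
  then show ?thesis using K(1) by (intro exI[of _ "sqrt K"]) auto
qed

section \<open>Density of the range\<close>

text \<open>One constant serves both inequalities; it determines the step size in the gradient descent
  below.\<close>

lemma norm_A_sq_le:
  "\<exists>c>0. \<forall>x. (norm (A x))\<^sup>2 \<le> c * (normA A x)\<^sup>2 \<and> (normA A x)\<^sup>2 \<le> c * (norm x)\<^sup>2"
proof -
  obtain K where K: "K > 0" "\<And>x. normA A x \<le> K * norm x"
    using normA_le_norm by blast
  have "(norm (A x))\<^sup>2 \<le> K\<^sup>2 * (normA A x)\<^sup>2" for x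
  proof -
    have "(norm (A x))\<^sup>2 = cmod (innerA A x (A x))"
      by (simp add: innerA_def cinner_self norm_power)
    also have "\<dots> \<le> normA A x * normA A (A x)"
      by (rule innerA_cauchy_schwarz)
    also have "\<dots> \<le> normA A x * (K * norm (A x))"
      by (intro mult_left_mono K) simp
    finally have "norm (A x) * norm (A x) \<le> (K * normA A x) * norm (A x)"
      by (simp add: power2_eq_square algebra_simps)
    then have "norm (A x) \<le> K * normA A x"
      using K(1) by (cases "A x = 0") auto
    then show ?thesis
      by (metis norm_ge_zero power_mono power_mult_distrib)
  qed
  moreover have "(normA A x)\<^sup>2 \<le> K\<^sup>2 * (norm x)\<^sup>2" for x
    using power_mono[OF K(2)[of x], of 2] by (simp add: power_mult_distrib)
  ultimately show ?thesis using K(1) by (intro exI[of _ "K\<^sup>2"]) auto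
qed

text \<open>The iteration \<open>u \<mapsto> u - t A u\<close> is gradient descent for half the squared
  A-seminorm, and it never leaves the coset \<open>x + range A\<close>. For a small step size \<open>t\<close> the
  norms of the iterates do not increase, while each step lowers the squared A-seminorm by at least
  \<open>t \<parallel>A u\<parallel>\<^sup>2\<close>. So \<open>\<Sum> \<parallel>A u\<^sub>n\<parallel>\<^sup>2\<close> converges, \<open>A u\<^sub>n\<close> tends to 0, and
  \<open>\<parallel>u\<^sub>n\<parallel>\<^sub>A\<^sup>2 = \<langle>A u\<^sub>n, u\<^sub>n\<rangle> \<le> \<parallel>A u\<^sub>n\<parallel> \<parallel>x\<parallel>\<close> tends to 0 as well. This avoids both the
  square root of \<open>A\<close> and the orthogonal projection onto the closure of its range.\<close>

lemma range_dense:
  assumes "e > 0"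
  shows "\<exists>y. normA A (x - A y) < e"
proof -
  obtain c where c: "c > 0" "\<And>x. (norm (A x))\<^sup>2 \<le> c * (normA A x)\<^sup>2"
    "\<And>x. (normA A x)\<^sup>2 \<le> c * (norm x)\<^sup>2"
    using norm_A_sq_le by blast
  define t where "t = 1 / c"
  have t: "t > 0" "t * c = 1" using c(1) by (simp_all add: t_def)
  define u where "u = rec_nat x (\<lambda>_ v. v - t *\<^sub>R A v)"
  have u0: "u 0 = x" and uS: "\<And>n. u (Suc n) = u n - t *\<^sub>R A (u n)"
    by (simp_all add: u_def)
  have scale: "t *\<^sub>R v = complex_of_real t *\<^sub>C v" for v :: 'a
    by (simp add: scaleC_of_real)
  have in_coset: "\<exists>y. u n = x - A y" for n
  proof (induction n)
    case 0
    show ?case by (intro exI[of _ 0]) (simp add: u0 A_simps)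
  next
    case (Suc n)
    then obtain y where "u n = x - A y" by blast
    then show ?case
      by (intro exI[of _ "y + t *\<^sub>R u n"]) (simp add: uS A_simps algebra_simps)
  qed
  have norm_step: "(norm (v - t *\<^sub>R A v))\<^sup>2 \<le> (norm v)\<^sup>2" for v
  proof -
    have "(norm (v - t *\<^sub>R A v))\<^sup>2 = (norm v)\<^sup>2 - 2 * t * (normA A v)\<^sup>2 + t\<^sup>2 * (norm (A v))\<^sup>2"
      unfolding norm_sq_cinner normA_sq innerA_def scale
      by (simp add: cinner_diff_left cinner_diff_right cinner_scaleC_left cinner_scaleC_right
          self_adjoint power2_eq_square algebra_simps)
    also have "\<dots> \<le> (norm v)\<^sup>2 - 2 * t * (normA A v)\<^sup>2 + t\<^sup>2 * (c * (normA A v)\<^sup>2)"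
      using c(2)[of v] by (simp add: mult_left_mono)
    also have "\<dots> = (norm v)\<^sup>2 - t * (normA A v)\<^sup>2"
      using t(2) by algebra
    also have "\<dots> \<le> (norm v)\<^sup>2" using t(1) by simp
    finally show ?thesis .
  qed
  have bounded: "norm (u n) \<le> norm x" for n
  proof (induction n)
    case (Suc n)
    have "norm (u (Suc n)) \<le> norm (u n)"
      unfolding uS by (rule power2_le_imp_le[OF norm_step]) simp
    then show ?case using Suc by simp
  qed (simp add: u0)
  have normA_step: "t * (norm (A v))\<^sup>2 \<le> (normA A v)\<^sup>2 - (normA A (v - t *\<^sub>R A v))\<^sup>2" for v
  proof -
    have "Re (innerA A v (t *\<^sub>R A v)) = t * (norm (A v))\<^sup>2"
      by (simp add: innerA_def scale cinner_scaleC_right cinner_self flip: of_real_power)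
    moreover have "(normA A (t *\<^sub>R A v))\<^sup>2 = t\<^sup>2 * (normA A (A v))\<^sup>2"
      using t(1) by (simp add: scale normA_scaleC power_mult_distrib)
    moreover have "t\<^sup>2 * (normA A (A v))\<^sup>2 \<le> t * (norm (A v))\<^sup>2"
    proof -
      have "t\<^sup>2 * (normA A (A v))\<^sup>2 \<le> t\<^sup>2 * (c * (norm (A v))\<^sup>2)"
        by (intro mult_left_mono c) simp
      also have "\<dots> = t * c * (t * (norm (A v))\<^sup>2)"
        by (simp add: power2_eq_square)
      finally show ?thesis by (simp add: t)
    qed
    ultimately show ?thesis by (simp add: normA_diff_sq)
  qed
  have "(\<Sum>i<n. t * (norm (A (u i)))\<^sup>2) \<le> (normA A x)\<^sup>2 - (normA A (u n))\<^sup>2" for n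
  proof (induction n)
    case (Suc n)
    then show ?case using normA_step[of "u n"] by (simp add: uS)
  qed (simp add: u0)
  then have "(\<Sum>i<n. t * (norm (A (u i)))\<^sup>2) \<le> (normA A x)\<^sup>2" for n
    by (smt (verit) zero_le_power2)
  then have partial: "(\<Sum>i\<le>n. t * (norm (A (u i)))\<^sup>2) \<le> (normA A x)\<^sup>2" for n
    unfolding lessThan_Suc_atMost[symmetric] .
  have "summable (\<lambda>i. t * (norm (A (u i)))\<^sup>2)"
    by (rule bounded_imp_summable[OF _ partial]) (use t(1) in simp)
  then have "(\<lambda>i. t * (norm (A (u i)))\<^sup>2) \<longlonglongrightarrow> 0"
    by (rule summable_LIMSEQ_zero)
  from tendsto_mult_left[OF this, of c] have "(\<lambda>i. (norm (A (u i)))\<^sup>2) \<longlonglongrightarrow> 0"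
    using c(1) by (simp add: t_def)
  then have "(\<lambda>i. sqrt ((norm (A (u i)))\<^sup>2) * norm x) \<longlonglongrightarrow> sqrt 0 * norm x"
    by (intro tendsto_mult_right tendsto_real_sqrt)
  then have lim: "(\<lambda>i. norm (A (u i)) * norm x) \<longlonglongrightarrow> 0"
    by simp
  have "(normA A (u i))\<^sup>2 \<le> norm (A (u i)) * norm x" for i
  proof -
    have "(normA A (u i))\<^sup>2 \<le> cmod (cinner (A (u i)) (u i))"
      unfolding normA_sq innerA_def by (rule complex_Re_le_cmod)
    also have "\<dots> \<le> norm (A (u i)) * norm (u i)"
      by (rule cinner_cauchy_schwarz)
    also have "\<dots> \<le> norm (A (u i)) * norm x"
      by (simp add: bounded mult_left_mono)
    finally show ?thesis .
  qed
  moreover obtain i where "norm (A (u i)) * norm x < e\<^sup>2"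
    using eventually_happens'[OF sequentially_bot order_tendstoD(2)[OF lim, of "e\<^sup>2"]] assms
    by auto
  ultimately have "(normA A (u i))\<^sup>2 < e\<^sup>2"
    using order_le_less_trans by blast
  then have "normA A (u i) < e"
    by (rule power2_less_imp_less) (use assms in simp)
  then show ?thesis using in_coset[of i] by auto
qed


section \<open>The seminorms of A-bounded operators\<close>

definition A_bounded :: "('a \<Rightarrow> 'a) \<Rightarrow> bool"
  where "A_bounded T \<longleftrightarrow> bounded_clinear T \<and> (\<exists>C. \<forall>x. normA A (T x) \<le> C * normA A x)"

lemma A_bounded_bound:
  assumes "A_bounded T"
  obtains C where "C \<ge> 0" "\<And>x. normA A (T x) \<le> C * normA A x"
proof -
  obtain C where C: "\<And>x. normA A (T x) \<le> C * normA A x"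
    using assms by (auto simp: A_bounded_def)
  have "C * normA A x \<le> \<bar>C\<bar> * normA A x" for x
    by (simp add: mult_right_mono)
  then show thesis
    using C by (intro that[of "\<bar>C\<bar>"]) (auto intro: order_trans)
qed

lemma A_bounded_linear: "A_bounded T \<Longrightarrow> bounded_linear T"
  and A_bounded_scaleC: "A_bounded T \<Longrightarrow> T (c *\<^sub>C x) = c *\<^sub>C T x"
  by (simp_all add: A_bounded_def bounded_clinear_def)

lemma scaleC_diff_right: "c *\<^sub>C (x - y) = c *\<^sub>C x - c *\<^sub>C (y :: 'a)"
  by (metis add_diff_cancel diff_add_cancel scaleC_add_right)

lemma A_bounded_add:
  assumes "A_bounded S" "A_bounded T"
  shows "A_bounded (S + T)"
proof -
  obtain C where C: "\<And>x. normA A (S x) \<le> C * normA A x"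
    using A_bounded_bound[OF assms(1)] by blast
  obtain D where D: "\<And>x. normA A (T x) \<le> D * normA A x"
    using A_bounded_bound[OF assms(2)] by blast
  have "normA A (S x + T x) \<le> (C + D) * normA A x" for x
    using normA_triangle[of "S x" "T x"] C[of x] D[of x] by (simp add: algebra_simps)
  moreover have "bounded_clinear (S + T)"
    using assms unfolding A_bounded_def bounded_clinear_def plus_fun_def
    by (auto intro: bounded_linear_add simp: scaleC_add_right)
  ultimately show ?thesis
    unfolding A_bounded_def by auto
qed

lemma A_bounded_diff:
  assumes "A_bounded S" "A_bounded T"
  shows "A_bounded (S - T)"
proof -
  obtain C where C: "\<And>x. normA A (S x) \<le> C * normA A x"
    using A_bounded_bound[OF assms(1)] by blast
  obtain D where D: "\<And>x. normA A (T x) \<le> D * normA A x"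
    using A_bounded_bound[OF assms(2)] by blast
  have "normA A (S x - T x) \<le> (C + D) * normA A x" for x
    using normA_triangle_diff[of "S x" "T x"] C[of x] D[of x] by (simp add: algebra_simps)
  moreover have "bounded_clinear (S - T)"
    using assms unfolding A_bounded_def bounded_clinear_def fun_diff_def
    by (auto intro: bounded_linear_sub simp: scaleC_diff_right)
  ultimately show ?thesis
    unfolding A_bounded_def by auto
qed

text \<open>The supremum that defines \<open>opnormA\<close> gives the estimate on the range of \<open>A\<close>. By A-boundedness
  both sides are continuous in the A-seminorm, so density of the range extends it to every
  vector.\<close>

lemma
  assumes "A_bounded T"
  shows opnormA_nonneg: "0 \<le> opnormA A T"
    and normA_le_opnormA: "normA A (T x) \<le> opnormA A T * normA A x"
proof -
  obtain C where C: "C \<ge> 0" "\<And>x. normA A (T x) \<le> C * normA A x"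
    using A_bounded_bound[OF assms] by blast
  define R where "R = insert 0 {normA A (T x) / normA A x | x. x \<in> closure (range A) \<and> x \<noteq> 0}"
  have R: "opnormA A T = Sup R"
    by (simp add: opnormA_def R_def)
  have "normA A (T x) / normA A x \<le> C" for x
  proof (cases "normA A x = 0")
    case False
    then have "0 < normA A x"
      using normA_nonneg[of x] by linarith
    then show ?thesis using C(2)[of x] by (simp add: pos_divide_le_eq)
  qed (simp add: C)
  then have "bdd_above R"
    using C(1) by (auto simp: R_def intro!: bdd_aboveI[of _ C])
  then have upper: "r \<le> opnormA A T" if "r \<in> R" for r
    unfolding R using that by (intro cSup_upper)
  show nonneg: "0 \<le> opnormA A T"
    by (rule upper) (simp add: R_def)
  have on_range: "normA A (T (A v)) \<le> opnormA A T * normA A (A v)" for v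
  proof (cases "normA A (A v) = 0")
    case True
    then show ?thesis using C(2)[of "A v"] by simp
  next
    case False
    then have "A v \<noteq> 0"
      by (auto simp: normA_def innerA_def)
    then have "normA A (T (A v)) / normA A (A v) \<in> R"
      using closure_subset[of "range A"] by (auto simp: R_def)
    then have "normA A (T (A v)) / normA A (A v) \<le> opnormA A T"
      by (rule upper)
    moreover have "0 < normA A (A v)"
      using False normA_nonneg[of "A v"] by linarith
    ultimately show ?thesis
      by (simp add: pos_divide_le_eq)
  qed
  show "normA A (T x) \<le> opnormA A T * normA A x"
  proof (rule field_le_epsilon)
    fix e :: real assume e: "e > 0"
    \<comment> \<open>Replacing \<open>x\<close> by \<open>A v\<close> costs less than \<open>d\<close> in \<open>normA A x\<close> and at most \<open>C * d\<close> in
      \<open>normA A (T x)\<close>; adding 1 keeps the denominator positive.\<close>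
    define d where "d = e / (opnormA A T + C + 1)"
    have d: "d > 0" using e nonneg C(1) by (simp add: d_def)
    obtain v where v: "normA A (x - A v) < d"
      using range_dense[OF d] by blast
    have Tx: "T x = T (A v) + T (x - A v)"
      using linear_simps[OF A_bounded_linear[OF assms]] by simp
    have "normA A (A v) \<le> normA A x + normA A (x - A v)"
      using normA_triangle_diff[of x "x - A v"] by simp
    then have "normA A (A v) \<le> normA A x + d"
      using v by simp
    then have "opnormA A T * normA A (A v) \<le> opnormA A T * (normA A x + d)"
      using nonneg by (rule mult_left_mono)
    moreover have "normA A (T (x - A v)) \<le> C * d"
      using C(2)[of "x - A v"] mult_left_mono[OF less_imp_le[OF v] C(1)] by linarith
    ultimately have "normA A (T x) \<le> opnormA A T * normA A x + (opnormA A T + C) * d"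
      unfolding Tx using normA_triangle[of "T (A v)" "T (x - A v)"] on_range[of v]
      by (simp add: algebra_simps)
    also have "(opnormA A T + C) * d \<le> (opnormA A T + C + 1) * d"
      using d by simp
    also have "(opnormA A T + C + 1) * d = e"
      using nonneg C(1) by (simp add: d_def)
    finally show "normA A (T x) \<le> opnormA A T * normA A x + e" by simp
  qed
qed

lemma wA_leI:
  assumes "C \<ge> 0" "\<And>x. cmod (innerA A (T x) x) \<le> C * (normA A x)\<^sup>2"
  shows "wA A T \<le> C"
  unfolding wA_def
proof (rule cSup_least)
  fix r assume "r \<in> insert 0 {cmod (innerA A (T x) x) | x. normA A x = 1}"
  then show "r \<le> C"
    using assms by (auto, metis mult.right_neutral power_one)
qed simp

lemma
  assumes "A_bounded T"
  shows wA_nonneg: "0 \<le> wA A T"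
    and cmod_innerA_le_wA: "cmod (innerA A (T x) x) \<le> wA A T * (normA A x)\<^sup>2"
proof -
  obtain C where C: "C \<ge> 0" "\<And>x. normA A (T x) \<le> C * normA A x"
    using A_bounded_bound[OF assms] by blast
  define R where "R = insert 0 {cmod (innerA A (T x) x) | x. normA A x = 1}"
  have "cmod (innerA A (T x) x) \<le> C" if "normA A x = 1" for x
    using innerA_cauchy_schwarz[of "T x" x] C(2)[of x] that by simp
  then have "bdd_above R"
    using C(1) by (auto simp: R_def intro!: bdd_aboveI[of _ C])
  then have upper: "r \<le> wA A T" if "r \<in> R" for r
    using that unfolding wA_def R_def by (intro cSup_upper)
  show "0 \<le> wA A T"
    by (rule upper) (simp add: R_def)
  \<comment> \<open>Normalize \<open>x\<close>; if its seminorm is 0, the Cauchy-Schwarz inequality makes both sides 0.\<close>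
  show "cmod (innerA A (T x) x) \<le> wA A T * (normA A x)\<^sup>2"
  proof (cases "normA A x = 0")
    case True
    then show ?thesis using innerA_cauchy_schwarz[of "T x" x] by simp
  next
    case False
    define c where "c = complex_of_real (1 / normA A x)"
    define y where "y = c *\<^sub>C x"
    have "normA A y = 1"
      using False by (simp add: y_def c_def normA_scaleC norm_divide)
    then have "cmod (innerA A (T y) y) \<le> wA A T"
      by (intro upper) (auto simp: R_def)
    moreover have "innerA A (T y) y = c * cnj c * innerA A (T x) x"
      by (simp add: y_def A_bounded_scaleC[OF assms] innerA_simps)
    then have "cmod (innerA A (T y) y) = cmod (innerA A (T x) x) / (normA A x)\<^sup>2"
      by (simp add: c_def norm_mult norm_divide power2_eq_square)
    ultimately show ?thesis
      using False by (simp add: pos_divide_le_eq)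
  qed
qed

text \<open>Polarization writes twice the symmetrized form as the difference of the quadratic form at
  \<open>x + y\<close> and at \<open>x - y\<close>; the parallelogram law then adds up the two seminorms. In operator terms,
  tensoring with the flip matrix does not increase the numerical radius.\<close>

lemma cmod_symmetric_pair_le_wA:
  assumes "A_bounded T"
  shows "cmod (innerA A (T x) y + innerA A (T y) x) \<le> wA A T * ((normA A x)\<^sup>2 + (normA A y)\<^sup>2)"
proof -
  note T = linear_simps[OF A_bounded_linear[OF assms]]
  have "2 * (innerA A (T x) y + innerA A (T y) x)
      = innerA A (T (x + y)) (x + y) - innerA A (T (x - y)) (x - y)"
    by (simp add: T innerA_simps)
  then have "2 * cmod (innerA A (T x) y + innerA A (T y) x)
      = cmod (innerA A (T (x + y)) (x + y) - innerA A (T (x - y)) (x - y))"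
    by (metis norm_mult norm_numeral)
  also have "\<dots> \<le> cmod (innerA A (T (x + y)) (x + y)) + cmod (innerA A (T (x - y)) (x - y))"
    by (rule norm_triangle_ineq4)
  also have "\<dots> \<le> wA A T * (normA A (x + y))\<^sup>2 + wA A T * (normA A (x - y))\<^sup>2"
    by (intro add_mono cmod_innerA_le_wA assms)
  also have "\<dots> = 2 * (wA A T * ((normA A x)\<^sup>2 + (normA A y)\<^sup>2))"
    by (simp add: normA_add_sq normA_diff_sq algebra_simps)
  finally show ?thesis by simp
qed

text \<open>The common part of the next two estimates, where \<open>2 R\<close> is a sum or difference of \<open>S\<close> and
  \<open>T\<close>.\<close>

lemma wA_le_of_double_le:
  assumes "A_bounded S" "A_bounded T"
    and double: "\<And>x. normA A (R x + R x) \<le> normA A (S x) + normA A (T x)"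
  shows "2 * wA A R \<le> opnormA A S + opnormA A T"
proof -
  have double_normA: "2 * normA A x = normA A (x + x)" for x
    using normA_scaleC[of 2 x] scaleC_add_left[of 1 1 x] scaleC_of_real[of 1 x] by simp
  define C where "C = (opnormA A S + opnormA A T) / 2"
  have bound: "normA A (R x) \<le> C * normA A x" for x
    using double[of x] double_normA[of "R x"]
      normA_le_opnormA[OF assms(1), of x] normA_le_opnormA[OF assms(2), of x]
    by (simp add: C_def algebra_simps add_divide_distrib)
  have "wA A R \<le> C"
  proof (rule wA_leI)
    show "C \<ge> 0" using opnormA_nonneg assms by (simp add: C_def)
    show "cmod (innerA A (R x) x) \<le> C * (normA A x)\<^sup>2" for x
      using innerA_cauchy_schwarz[of "R x" x] mult_right_mono[OF bound[of x] normA_nonneg[of x]]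
      by (simp add: power2_eq_square mult.assoc)
  qed
  then show ?thesis by (simp add: C_def)
qed

lemma
  assumes "A_bounded S" "A_bounded T"
  shows wA_le_opnormA_diff_add: "2 * wA A S \<le> opnormA A (S - T) + opnormA A (S + T)"
    and wA_le_opnormA_diff_add': "2 * wA A T \<le> opnormA A (S - T) + opnormA A (S + T)"
proof -
  note bounded = A_bounded_diff[OF assms] A_bounded_add[OF assms]
  show "2 * wA A S \<le> opnormA A (S - T) + opnormA A (S + T)"
  proof (rule wA_le_of_double_le[OF bounded])
    show "normA A (S x + S x) \<le> normA A ((S - T) x) + normA A ((S + T) x)" for x
      using normA_triangle[of "S x - T x" "S x + T x"] by simp
  qed
  show "2 * wA A T \<le> opnormA A (S - T) + opnormA A (S + T)"
  proof (rule wA_le_of_double_le[OF bounded])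
    show "normA A (T x + T x) \<le> normA A ((S - T) x) + normA A ((S + T) x)" for x
      using normA_triangle_diff[of "S x + T x" "S x - T x"] by (simp add: add.commute)
  qed
qed

end

section \<open>Operators with an A-adjoint are A-bounded\<close>

text \<open>In a log-convex sequence the ratios of consecutive terms do not decrease, so a first ratio
  above \<open>k\<close> forces growth faster than any multiple of \<open>k\<^sup>n\<close>.\<close>

lemma log_convex_growth:
  fixes b :: "nat \<Rightarrow> real"
  assumes nonneg: "\<And>n. 0 \<le> b n"
    and log_convex: "\<And>n. (b (Suc n))\<^sup>2 \<le> b n * b (Suc (Suc n))"
    and growth: "\<And>n. b n \<le> M * k ^ n" and k: "k > 0"
  shows "b 1 \<le> k * b 0"
proof (rule ccontr)
  assume "\<not> b 1 \<le> k * b 0"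
  then have less: "k * b 0 < b 1" by simp
  have b0: "b 0 > 0"
    using log_convex[of 0] less nonneg[of 0] by (cases "b 0 = 0") auto
  define r where "r = b 1 / b 0"
  have r: "r > k" using less b0 by (simp add: r_def pos_less_divide_eq)
  have ratio: "b n > 0 \<and> r * b n \<le> b (Suc n)" for n
  proof (induction n)
    case 0
    then show ?case using b0 by (simp add: r_def)
  next
    case (Suc n)
    then have pos: "b (Suc n) > 0"
      using r k by (smt (verit) mult_pos_pos)
    have "b n * (r * b (Suc n)) \<le> (b (Suc n))\<^sup>2"
      using mult_right_mono[of "r * b n" "b (Suc n)" "b (Suc n)"] Suc pos
      by (simp add: power2_eq_square algebra_simps)
    also have "\<dots> \<le> b n * b (Suc (Suc n))" by (rule log_convex)
    finally show ?case using Suc pos by simp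
  qed
  have lower: "r ^ n * b 0 \<le> b n" for n
  proof (induction n)
    case (Suc n)
    have "r * (r ^ n * b 0) \<le> r * b n" using Suc r k by (intro mult_left_mono) auto
    then show ?case using ratio[of n] by (simp add: mult.assoc)
  qed simp
  obtain n where "M / b 0 < (r / k) ^ n"
    using real_arch_pow[of "r / k"] r k by auto
  then have "M * k ^ n < r ^ n * b 0"
    using b0 k by (simp add: field_simps power_divide)
  then show False
    using lower[of n] growth[of n] by simp
qed

text \<open>If \<open>A X = T\<^sup>* A\<close>, then \<open>S = X T\<close> satisfies
  \<open>\<langle>S x, y\<rangle>\<^sub>A = \<langle>T x, T y\<rangle>\<^sub>A = \<langle>x, S y\<rangle>\<^sub>A\<close>, hence \<open>\<parallel>T x\<parallel>\<^sub>A\<^sup>2 \<le> \<parallel>x\<parallel>\<^sub>A \<parallel>S x\<parallel>\<^sub>A\<close> and it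
  suffices to bound \<open>S\<close>. Symmetry and the Cauchy-Schwarz inequality make \<open>n \<mapsto> \<parallel>S\<^sup>n x\<parallel>\<^sub>A\<close> log-convex.
  As \<open>\<parallel>\<cdot>\<parallel>\<^sub>A\<close> is dominated by the norm, this sequence grows at most like the powers of a bound of
  \<open>S\<close> in the norm, and so this bound also holds in the A-seminorm.\<close>

lemma BA_imp_A_bounded:
  fixes A :: "'a::chilbert_space \<Rightarrow> 'a"
  assumes "positive_op A" "T \<in> BA A"
  shows "positive_operator.A_bounded A T"
proof -
  interpret positive_operator A by standard (rule assms)
  obtain X where T: "bounded_clinear T" and X: "bounded_clinear X"
    and AX: "\<And>x. A (X x) = cadjoint T (A x)"
    using assms(2) by (auto simp: BA_def fun_eq_iff)
  define S where "S = X \<circ> T"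
  have S_right: "innerA A (T x) (T y) = innerA A x (S y)" for x y
    unfolding innerA_def S_def
    by (simp add: self_adjoint cadjoint_works[OF T] AX)
  have S_left: "innerA A (T x) (T y) = innerA A (S x) y" for x y
    by (metis S_right innerA_commute)
  have "bounded_linear S"
    using T X unfolding S_def bounded_clinear_def by (auto intro: bounded_linear_compose simp: o_def)
  then obtain k where k: "k > 0" "\<And>x. norm (S x) \<le> norm x * k"
    using bounded_linear.pos_bounded by blast
  obtain K where K: "K > 0" "\<And>x. normA A x \<le> K * norm x"
    using normA_le_norm by blast
  have S_bound: "normA A (S x) \<le> k * normA A x" for x
  proof -
    define b where "b n = normA A ((S ^^ n) x)" for n
    have "b 1 \<le> k * b 0"
    proof (rule log_convex_growth)
      show "0 \<le> b n" for n by (simp add: b_def)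
      show "(b (Suc n))\<^sup>2 \<le> b n * b (Suc (Suc n))" for n
      proof -
        have "(b (Suc n))\<^sup>2 = Re (innerA A ((S ^^ n) x) ((S ^^ Suc (Suc n)) x))"
          unfolding b_def normA_sq by (simp add: S_left[symmetric] S_right)
        also have "\<dots> \<le> b n * b (Suc (Suc n))"
          unfolding b_def using complex_Re_le_cmod innerA_cauchy_schwarz order_trans by blast
        finally show ?thesis .
      qed
      have iterate: "norm ((S ^^ n) x) \<le> norm x * k ^ n" for n
      proof (induction n)
        case (Suc n)
        have "norm (S ((S ^^ n) x)) \<le> norm ((S ^^ n) x) * k"
          by (rule k)
        also have "\<dots> \<le> norm x * k ^ n * k"
          using Suc k(1) by (intro mult_right_mono) auto
        finally show ?case by (simp add: mult_ac)
      qed simp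
      show "b n \<le> K * norm x * k ^ n" for n
        unfolding b_def mult.assoc
        using K(1) by (intro order_trans[OF K(2)] mult_left_mono iterate) simp
    qed (rule k)
    then show ?thesis by (simp add: b_def)
  qed
  have "normA A (T x) \<le> sqrt k * normA A x" for x
  proof (rule power2_le_imp_le)
    have "(normA A (T x))\<^sup>2 \<le> normA A x * normA A (S x)"
      unfolding normA_sq[of "T x"] S_right
      using complex_Re_le_cmod innerA_cauchy_schwarz order_trans by blast
    also have "\<dots> \<le> normA A x * (k * normA A x)"
      by (intro mult_left_mono S_bound) simp
    also have "\<dots> = (sqrt k * normA A x)\<^sup>2"
      using k(1) by (simp add: power_mult_distrib power2_eq_square[of "normA A x"])
    finally show "(normA A (T x))\<^sup>2 \<le> (sqrt k * normA A x)\<^sup>2" .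
  qed (use k(1) in simp)
  then show ?thesis using T by (auto simp: A_bounded_def)
qed

section \<open>Numerical radius of the operator matrix\<close>

lemma UNIV_5: "(UNIV :: 5 set) = {1, 2, 3, 4, 5}"
proof -
  have "x \<in> {1, 2, 3, 4, 5}" for x :: 5
  proof (induct x)
    case (of_int z)
    \<comment> \<open>The representative 0 is the index that the numeral 5 denotes.\<close>
    then have "z = 0 \<or> z = 1 \<or> z = 2 \<or> z = 3 \<or> z = 4" by simp arith
    then show ?case by auto
  qed
  then show ?thesis by auto
qed

lemma sum_5: "sum f (UNIV :: 5 set) = f 1 + f 2 + f 3 + f 4 + f 5"
  unfolding UNIV_5 by (simp add: ac_simps)

lemma innerA_diagonal:
  "innerA (op_matrix (mat A)) x y = (\<Sum>i\<in>UNIV. innerA A (x $ i) (y $ i))"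
  by (simp add: innerA_def op_matrix_mat cinner_vec_def)

lemma sum_in_nonneg_Reals: "(\<And>i. i \<in> I \<Longrightarrow> f i \<in> \<real>\<^sub>\<ge>\<^sub>0) \<Longrightarrow> sum f I \<in> \<real>\<^sub>\<ge>\<^sub>0"
  by (induction I rule: infinite_finite_induct) (auto intro: nonneg_Reals_add_I)

lemma positive_op_diagonal:
  fixes A :: "'a::complex_inner \<Rightarrow> 'a"
  assumes "positive_op A"
  shows "positive_op (op_matrix (mat A :: ('a \<Rightarrow> 'a) ^ 'n::finite ^ 'n))"
proof -
  interpret positive_operator A by standard (rule assms)
  obtain K where K: "K > 0" "\<And>x. norm (A x) \<le> norm x * K"
    using bounded_linear.pos_bounded[OF bounded_linear_A] by blast
  have "bounded_linear (\<lambda>x :: 'a ^ 'n. \<chi> i. A (x $ i))"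
  proof (rule bounded_linear_intro)
    show "norm (\<chi> i. A (x $ i)) \<le> norm x * K" for x :: "'a ^ 'n"
    proof -
      have "norm (\<chi> i. A (x $ i)) \<le> L2_set (\<lambda>i. norm (x $ i) * K) UNIV"
        unfolding norm_vec_def by (rule L2_set_mono) (simp_all add: K)
      also have "\<dots> = norm x * K"
        using K(1) by (simp add: norm_vec_def L2_set_left_distrib)
      finally show ?thesis .
    qed
  qed (simp_all add: vec_eq_iff A_simps)
  moreover have "cinner (\<chi> i. A (x $ i)) x \<in> \<real>\<^sub>\<ge>\<^sub>0" for x :: "'a ^ 'n"
    unfolding cinner_vec_def using innerA_self_nonneg
    by (intro sum_in_nonneg_Reals) (simp add: innerA_def)
  ultimately show ?thesis
    unfolding positive_op_def bounded_clinear_def op_matrix_mat[abs_def]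
    by (simp add: vec_eq_iff scaleC_vec_def A_simps)
qed

lemma normA_sq_diagonal:
  fixes A :: "'a::complex_inner \<Rightarrow> 'a" and x :: "'a ^ 'n::finite"
  assumes "positive_op A"
  shows "(normA (op_matrix (mat A)) x)\<^sup>2 = (\<Sum>i\<in>UNIV. (normA A (x $ i))\<^sup>2)"
proof -
  interpret positive_operator A by standard (rule assms)
  interpret diag: positive_operator "op_matrix (mat A :: ('a \<Rightarrow> 'a) ^ 'n ^ 'n)"
    by standard (rule positive_op_diagonal[OF assms])
  show ?thesis
    by (simp add: normA_sq diag.normA_sq innerA_diagonal)
qed

theorem proposition4p8:
  fixes A :: "'a::chilbert_space \<Rightarrow> 'a"
    and T :: "nat \<Rightarrow> 'a \<Rightarrow> 'a"
  assumes "positive_op A"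
    and "\<And>k. k \<in> {1..5} \<Longrightarrow> T k \<in> BA A"
  shows "wA (op_matrix (mat A :: ('a \<Rightarrow> 'a) ^ 5 ^ 5))
          (op_matrix (vector
            [vector [T 1, T 2, T 3, T 4, T 5],
             vector [T 2, T 3, T 4, T 5, \<i> *\<^sub>O T 1],
             vector [T 3, T 4, T 5, \<i> *\<^sub>O T 1, \<i> *\<^sub>O T 2],
             vector [T 4, T 5, \<i> *\<^sub>O T 1, \<i> *\<^sub>O T 2, \<i> *\<^sub>O T 3],
             vector [T 5, \<i> *\<^sub>O T 1, \<i> *\<^sub>O T 2, \<i> *\<^sub>O T 3, \<i> *\<^sub>O T 4]]))
        \<le> wA A (T 5) + max (wA A (T 2)) (wA A (T 3)) + max (wA A (T 1)) (wA A (T 4))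
          + 1 / sqrt 2 * (\<Sum>k = 1..3. opnormA A (T (k + 1) - T k) + opnormA A (T (k + 1) + T k))
          + sqrt ((wA A (T 4))\<^sup>2 + (wA A (T 2))\<^sup>2)"
proof -
  interpret positive_operator A by standard (rule assms)
  interpret diag: positive_operator "op_matrix (mat A :: ('a \<Rightarrow> 'a) ^ 5 ^ 5)"
    by standard (rule positive_op_diagonal[OF assms(1)])
  define w where "w k = wA A (T k)" for k
  have bounded: "A_bounded (T k)" if "k \<in> {1..5}" for k
    using BA_imp_A_bounded assms that by blast
  have w_nonneg: "0 \<le> w k" if "k \<in> {1..5}" for k
    unfolding w_def by (rule wA_nonneg[OF bounded[OF that]])
  define M where "M = (vector
            [vector [T 1, T 2, T 3, T 4, T 5],
             vector [T 2, T 3, T 4, T 5, \<i> *\<^sub>O T 1],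
             vector [T 3, T 4, T 5, \<i> *\<^sub>O T 1, \<i> *\<^sub>O T 2],
             vector [T 4, T 5, \<i> *\<^sub>O T 1, \<i> *\<^sub>O T 2, \<i> *\<^sub>O T 3],
             vector [T 5, \<i> *\<^sub>O T 1, \<i> *\<^sub>O T 2, \<i> *\<^sub>O T 3, \<i> *\<^sub>O T 4]]
          :: ('a \<Rightarrow> 'a) ^ 5 ^ 5)"
  have matrix: "wA (op_matrix (mat A)) (op_matrix M) \<le> w 1 + w 2 + w 3 + w 4 + w 5"
  proof (rule diag.wA_leI)
    fix x :: "'a ^ 5"
    \<comment> \<open>In each line of \<open>form\<close> the operator is fixed and every index of \<open>x\<close> occurs in exactly one
      term, which is why the bounds add up to \<open>w k\<close> times the squared seminorm of \<open>x\<close>.\<close>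
    define p where "p k i j = innerA A (T k (x $ j)) (x $ i)" for k and i j :: 5
    define n where "n i = (normA A (x $ i))\<^sup>2" for i
    define s where "s k i j = p k i j + p k j i" for k i j
    have form: "innerA (op_matrix (mat A)) (op_matrix M x) x
        = (p 1 1 1 + \<i> * s 1 2 5 + \<i> * s 1 3 4)
        + (s 2 1 2 + \<i> * s 2 3 5 + \<i> * p 2 4 4)
        + (s 3 1 3 + p 3 2 2 + \<i> * s 3 4 5)
        + (s 4 1 4 + s 4 2 3 + \<i> * p 4 5 5)
        + (s 5 1 5 + s 5 2 4 + p 5 3 3)"
      unfolding innerA_diagonal op_matrix_def M_def
      by (simp add: sum_5 op_scale_def innerA_simps p_def s_def algebra_simps del: One_nat_def)
    have diagonal: "cmod (p k i i) \<le> w k * n i"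
      and pair: "cmod (s k i j) \<le> w k * (n j + n i)" if "k \<in> {1..5}" for k i j
      unfolding p_def s_def n_def w_def
      by (rule cmod_innerA_le_wA cmod_symmetric_pair_le_wA bounded that)+
    have triple: "cmod (a + b + c) \<le> \<alpha> + \<beta> + \<gamma>"
      if "cmod a \<le> \<alpha>" "cmod b \<le> \<beta>" "cmod c \<le> \<gamma>" for a b c \<alpha> \<beta> \<gamma>
      using that by (intro norm_triangle_le add_mono) auto
    have rotate: "cmod (\<i> * a) \<le> \<alpha>" if "cmod a \<le> \<alpha>" for a \<alpha>
      using that by (simp add: norm_mult)
    have "cmod (innerA (op_matrix (mat A)) (op_matrix M x) x)
        \<le> (w 1 * n 1 + w 1 * (n 5 + n 2) + w 1 * (n 4 + n 3))
        + (w 2 * (n 2 + n 1) + w 2 * (n 5 + n 3) + w 2 * n 4)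
        + (w 3 * (n 3 + n 1) + w 3 * n 2 + w 3 * (n 5 + n 4))
        + (w 4 * (n 4 + n 1) + w 4 * (n 3 + n 2) + w 4 * n 5)
        + (w 5 * (n 5 + n 1) + w 5 * (n 4 + n 2) + w 5 * n 3)"
      unfolding form
      by (intro triple norm_triangle_mono rotate diagonal pair) simp_all
    also have "\<dots> = (w 1 + w 2 + w 3 + w 4 + w 5) * (n 1 + n 2 + n 3 + n 4 + n 5)"
      by (simp add: algebra_simps)
    also have "n 1 + n 2 + n 3 + n 4 + n 5 = (normA (op_matrix (mat A)) x)\<^sup>2"
      by (simp add: normA_sq_diagonal[OF assms(1)] sum_5 n_def)
    finally show "cmod (innerA (op_matrix (mat A)) (op_matrix M x) x)
        \<le> (w 1 + w 2 + w 3 + w 4 + w 5) * (normA (op_matrix (mat A)) x)\<^sup>2" .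
  qed (simp add: w_nonneg)
  define d where "d k = opnormA A (T (k + 1) - T k) + opnormA A (T (k + 1) + T k)" for k
  \<comment> \<open>Each \<open>d k\<close> dominates the numerical radii of both operators in it. Below, \<open>d 1\<close> pays for
    \<open>w 1\<close>, \<open>d 2\<close> for \<open>w 2\<close> and \<open>d 3\<close> for \<open>w 4\<close>, so that \<open>w 3\<close> is left to the first
    maximum.\<close>
  have d: "2 * w k \<le> d k" "2 * w (k + 1) \<le> d k" if "k \<in> {1..3}" for k
    unfolding w_def d_def using that
    by (auto intro!: wA_le_opnormA_diff_add wA_le_opnormA_diff_add' bounded)
  have "w 1 + w 2 + w 4 \<le> 1 / 2 * (d 1 + d 2 + d 3)"
    using d(1)[of 1] d(1)[of 2] d(2)[of 3] by simp
  also have "\<dots> \<le> 1 / sqrt 2 * (d 1 + d 2 + d 3)"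
  proof (rule mult_right_mono)
    have "sqrt 2 \<le> 2" by (rule real_le_lsqrt) simp_all
    then show "1 / 2 \<le> 1 / sqrt (2 :: real)" by (simp add: frac_le)
    show "0 \<le> d 1 + d 2 + d 3"
      using d(1)[of 1] d(1)[of 2] d(1)[of 3] w_nonneg[of 1] w_nonneg[of 2] w_nonneg[of 3] by simp
  qed
  also have "d 1 + d 2 + d 3 = (\<Sum>k = 1..3. d k)"
    by (simp add: numeral_3_eq_3 numeral_2_eq_2)
  finally have "w 1 + w 2 + w 4 \<le> 1 / sqrt 2 * (\<Sum>k = 1..3. d k)" .
  moreover have "0 \<le> max (w 1) (w 4)" "w 3 \<le> max (w 2) (w 3)"
    using w_nonneg[of 1] by (simp_all add: le_max_iff_disj)
  moreover have "0 \<le> sqrt ((w 4)\<^sup>2 + (w 2)\<^sup>2)"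
    by simp
  ultimately show ?thesis
    using matrix unfolding M_def d_def w_def by linarith
qed

end
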